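(* Let $P=\Delta^1\times\Delta^1\times\Delta^2$ (the product of a square and a triangle). The minimal size of a cover of $P$ is $10$ simplices, and there is a triangulation of $P$ (using only vertices of $P$) with $10$ simplices.
   Context: $\Delta^d$ is the convex hull of the standard unit vectors of $\mathbb{R}^{d+1}$; $P$ is a $4$-dimensional polytope with $12$ vertices. A cover of $P$ is a collection of $4$-simplices, each spanned by vertices of $P$, whose union is $P$. A triangulation is a decomposition into $4$-simplices meeting face-to-face. *)

theory Defs
  imports "HOL-Analysis.Analysis"
begin

definition std_simplex :: "(real^'n) set" where
  "std_simplex = convex hull Basis"

definition prism_polytope :: "((real^2) \<times> (real^2) \<times> (real^3)) set" where
  "prism_polytope = std_simplex \<times> std_simplex \<times> std_simplex"

definition vertices :: "'a::euclidean_space set \<Rightarrow> 'a set" where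
  "vertices P = {v. v extreme_point_of P}"

definition simplex_of_vertices :: "nat \<Rightarrow> 'a::euclidean_space set \<Rightarrow> 'a set \<Rightarrow> bool" where
  "simplex_of_vertices d P S \<longleftrightarrow> int d simplex S \<and> (\<exists>V \<subseteq> vertices P. S = convex hull V)"

definition simplicial_cover :: "nat \<Rightarrow> 'a::euclidean_space set \<Rightarrow> 'a set set \<Rightarrow> bool" where
  "simplicial_cover d P \<C> \<longleftrightarrow>
     finite \<C> \<and> (\<forall>S\<in>\<C>. simplex_of_vertices d P S) \<and> \<Union>\<C> = P"

(* The library's triangulation supplies the condition that any two members meet in a common face. *)
definition vertex_triangulation :: "nat \<Rightarrow> 'a::euclidean_space set \<Rightarrow> 'a set set \<Rightarrow> bool" where
  "vertex_triangulation d P \<T> \<longleftrightarrow> simplicial_cover d P \<T> \<and> triangulation \<T>"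

end

theory Submission
  imports Defs
begin

text \<open>
  Lower bound: there are ten points of the polytope, no two of which lie in a common simplex spanned by
  five vertices, so every cover has at least ten members. Six of the points sit near the middle of the
  edges in the direction of the first factor, the other four near the triangles in the direction of the
  last factor. A point of the convex hull of a vertex set \<open>V\<close> is the mean of a random vertex in \<open>V\<close>
  whose marginals are the three components of the point; hence if, by the union bound, the random
  vertex lies in a box \<open>A \<times> B \<times> C\<close> with positive probability, then \<open>V\<close> meets that box. For two
  of the ten points these conditions together force \<open>V\<close> to have at least six elements.

  Upper bound: lifting the vertices 111, 123, 213, 222, any two of which differ in at least two
  factors, to height 0 and all others
  to height 2 induces a regular triangulation with ten cells. A cell is the set where one of ten linear
  functionals, each bounded by the height on all vertices, attains their maximum; the differences to the
  functionals of the neighbouring cells are, up to scaling, the barycentric coordinates of the cell.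
\<close>

section \<open>Vertices and coordinates\<close>

lemma Basis_vec: "(Basis :: (real^'n) set) = range (\<lambda>i. axis i 1)"
  by (auto simp: Basis_vec_def)

lemma inj_axis: "inj (\<lambda>i::'n::finite. axis i (1::real))"
  by (auto simp: inj_def axis_eq_axis)

lemma std_simplex_eq: "(std_simplex :: (real^'n) set) = {x. (\<forall>i. 0 \<le> x $ i) \<and> (\<Sum>i\<in>UNIV. x $ i) = 1}"
proof -
  have eq: "(\<Sum>v\<in>Basis. u v *\<^sub>R v) = (\<chi> i. u (axis i 1))" for u :: "real^'n \<Rightarrow> real"
    unfolding Basis_vec sum.reindex[OF inj_axis]
    by (simp add: vec_eq_iff axis_def if_distrib[of "\<lambda>x. _ * x"] cong: if_cong)
  have s: "(\<Sum>v\<in>Basis. u v) = (\<Sum>i\<in>UNIV. u (axis i 1))" for u :: "real^'n \<Rightarrow> real"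
    by (simp add: Basis_vec sum.reindex[OF inj_axis])
  show ?thesis
  proof (intro equalityI subsetI)
    fix x :: "real^'n" assume "x \<in> std_simplex"
    then show "x \<in> {x. (\<forall>i. 0 \<le> x $ i) \<and> (\<Sum>i\<in>UNIV. x $ i) = 1}"
      unfolding std_simplex_def convex_hull_finite[OF finite_Basis] eq s
      by (auto simp: Basis_vec)
  next
    fix x :: "real^'n" assume x: "x \<in> {x. (\<forall>i. 0 \<le> x $ i) \<and> (\<Sum>i\<in>UNIV. x $ i) = 1}"
    define u where "u = (\<lambda>v. x \<bullet> v)"
    have [simp]: "u (axis i 1) = x $ i" for i by (simp add: u_def inner_axis)
    show "x \<in> std_simplex"
      unfolding std_simplex_def convex_hull_finite[OF finite_Basis] eq s
      using x by (auto intro!: exI[of _ u] simp: Basis_vec vec_eq_iff)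
  qed
qed

lemma vertices_std_simplex: "vertices (std_simplex :: (real^'n) set) = range (\<lambda>i. axis i 1)"
proof -
  have "\<not> affine_dependent (Basis :: (real^'n) set)"
    using affine_dependent_imp_dependent independent_Basis by blast
  then show ?thesis
    by (auto simp: vertices_def std_simplex_def extreme_point_of_convex_hull_affine_independent Basis_vec)
qed

definition vtx :: "2 \<times> 2 \<times> 3 \<Rightarrow> (real^2) \<times> (real^2) \<times> (real^3)" where
  "vtx = (\<lambda>(i, j, k). (axis i 1, axis j 1, axis k 1))"

lemma inj_vtx: "inj vtx"
  by (auto simp: inj_def vtx_def axis_eq_axis)

lemma inner_vtx: "(a, b, c) \<bullet> vtx (i, j, k) = a $ i + b $ j + c $ k"
  by (simp add: vtx_def inner_axis)

text \<open>Extreme points are the singleton faces, and a product of nonempty sets is a face of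
  \<open>S \<times> T\<close> exactly when its factors are faces of \<open>S\<close> and
  \<open>T\<close>.\<close>

lemma vertices_Times: "vertices (S \<times> T) = vertices S \<times> vertices T"
proof -
  have "(a, b) extreme_point_of (S \<times> T) \<longleftrightarrow> a extreme_point_of S \<and> b extreme_point_of T" for a b
    using face_of_Times_eq[of "{a}" "{b}" S T] by (simp add: face_of_singleton)
  then show ?thesis by (auto simp: vertices_def)
qed

lemma vertices_prism: "vertices prism_polytope = range vtx"
  by (auto simp: prism_polytope_def vertices_Times vertices_std_simplex vtx_def image_def)

lemma mem_prism_polytope:
  "(x, y, t) \<in> prism_polytope \<longleftrightarrow>
    0 \<le> x$1 \<and> 0 \<le> x$2 \<and> x$1 + x$2 = 1 \<and> 0 \<le> y$1 \<and> 0 \<le> y$2 \<and> y$1 + y$2 = 1 \<and>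
    0 \<le> t$1 \<and> 0 \<le> t$2 \<and> 0 \<le> t$3 \<and> t$1 + t$2 + t$3 = 1"
  by (auto simp: prism_polytope_def std_simplex_eq forall_2 forall_3 sum_2 sum_3)

lemma convex_hull_vtx:
  "convex hull (vtx ` I) = {\<Sum>v\<in>I. u v *\<^sub>R vtx v |u. (\<forall>v\<in>I. 0 \<le> u v) \<and> sum u I = 1}"
proof -
  have f: "finite (vtx ` I)" by simp
  have inj: "inj_on vtx I" using inj_vtx by (rule inj_on_subset) simp
  have r: "(\<Sum>v\<in>vtx ` I. u v) = (\<Sum>v\<in>I. u (vtx v))" for u :: "_ \<Rightarrow> real"
    by (simp add: sum.reindex[OF inj])
  have r2: "(\<Sum>v\<in>vtx ` I. u v *\<^sub>R v) = (\<Sum>v\<in>I. u (vtx v) *\<^sub>R vtx v)" for u :: "_ \<Rightarrow> real"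
    by (simp add: sum.reindex[OF inj])
  have inv: "inv vtx (vtx v) = v" for v using inj_vtx by simp
  show ?thesis
    unfolding convex_hull_finite[OF f] r r2
  proof (intro equalityI subsetI)
    fix p assume "p \<in> {p. \<exists>u. (\<forall>x\<in>vtx ` I. 0 \<le> u x) \<and> (\<Sum>v\<in>I. u (vtx v)) = 1 \<and> (\<Sum>v\<in>I. u (vtx v) *\<^sub>R vtx v) = p}"
    then obtain u where "\<forall>x\<in>vtx ` I. 0 \<le> u x" "(\<Sum>v\<in>I. u (vtx v)) = 1" "(\<Sum>v\<in>I. u (vtx v) *\<^sub>R vtx v) = p"
      by blast
    then show "p \<in> {\<Sum>v\<in>I. u v *\<^sub>R vtx v |u. (\<forall>v\<in>I. 0 \<le> u v) \<and> sum u I = 1}"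
      by (auto intro!: exI[of _ "\<lambda>v. u (vtx v)"])
  next
    fix p assume "p \<in> {\<Sum>v\<in>I. u v *\<^sub>R vtx v |u. (\<forall>v\<in>I. 0 \<le> u v) \<and> sum u I = 1}"
    then obtain u where "\<forall>v\<in>I. 0 \<le> u v" "sum u I = 1" "p = (\<Sum>v\<in>I. u v *\<^sub>R vtx v)"
      by blast
    then show "p \<in> {p. \<exists>u. (\<forall>x\<in>vtx ` I. 0 \<le> u x) \<and> (\<Sum>v\<in>I. u (vtx v)) = 1 \<and> (\<Sum>v\<in>I. u (vtx v) *\<^sub>R vtx v) = p}"
      by (auto intro!: exI[of _ "\<lambda>v. u (inv vtx v)"] simp: inv)
  qed
qed

text \<open>Otherwise all generators, and with them the hull, would lie in the open halfspace above
  the value at \<open>p\<close>. The combinatorial conditions on \<open>I\<close> below are all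
  drawn from this, with suitable choices of \<open>a\<close>.\<close>

lemma hull_vtx_inner_le:
  assumes "p \<in> convex hull (vtx ` I)"
  shows "\<exists>v\<in>I. a \<bullet> vtx v \<le> a \<bullet> p"
proof (rule ccontr)
  assume "\<not> ?thesis"
  then have "vtx ` I \<subseteq> {q. a \<bullet> q > a \<bullet> p}" by auto
  then have "convex hull (vtx ` I) \<subseteq> {q. a \<bullet> q > a \<bullet> p}"
    by (intro hull_minimal convex_halfspace_gt)
  with assms show False by auto
qed

section \<open>Ten points in pairwise different simplices\<close>

text \<open>The functional \<open>a\<close> counts the components of a vertex that miss the box. Its
  value at the point is below 1, so some vertex of \<open>I\<close> has a count below 1; counts are
  integers, so this count is 0.\<close>

lemma hull_meets_box:
  assumes "(x, y, t) \<in> convex hull (vtx ` I)"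
    and "(\<Sum>i\<in>-A. x $ i) + (\<Sum>j\<in>-B. y $ j) + (\<Sum>k\<in>-C. t $ k) < 1"
  shows "\<exists>i j k. (i, j, k) \<in> I \<and> i \<in> A \<and> j \<in> B \<and> k \<in> C"
proof -
  define a :: "(real^2) \<times> (real^2) \<times> (real^3)"
    where "a = (\<chi> i. of_bool (i \<in> -A), \<chi> j. of_bool (j \<in> -B), \<chi> k. of_bool (k \<in> -C))"
  have "a \<bullet> (x, y, t) < 1"
    using assms(2) by (simp add: a_def inner_vec_def inner_prod_def sum.If_cases sum_negf of_bool_def
        if_distrib[of "\<lambda>x. x * _"] if_distrib[of uminus] Compl_eq cong: if_cong)
  moreover obtain v where "v \<in> I" "a \<bullet> vtx v \<le> a \<bullet> (x, y, t)"
    using hull_vtx_inner_le[OF assms(1), of a] by blast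
  moreover obtain i j k where "v = (i, j, k)" by (cases v)
  ultimately show ?thesis
    by (auto simp: a_def inner_vtx of_bool_def split: if_splits)
qed

text \<open>Here \<open>-a\<close> counts the hits in \<open>A\<close>, \<open>B\<close> and
  \<open>C\<close>. A mean above 1 forces a vertex with at least two hits.\<close>

lemma hull_vertex_in_two:
  assumes "(x, y, t) \<in> convex hull (vtx ` I)"
    and "1 < (\<Sum>i\<in>A. x $ i) + (\<Sum>j\<in>B. y $ j) + (\<Sum>k\<in>C. t $ k)"
  shows "\<exists>i j k. (i, j, k) \<in> I \<and> (i \<in> A \<and> j \<in> B \<or> i \<in> A \<and> k \<in> C \<or> j \<in> B \<and> k \<in> C)"
proof -
  define a :: "(real^2) \<times> (real^2) \<times> (real^3)"
    where "a = - (\<chi> i. of_bool (i \<in> A), \<chi> j. of_bool (j \<in> B), \<chi> k. of_bool (k \<in> C))"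
  have "a \<bullet> (x, y, t) < -1"
    using assms(2) by (simp add: a_def inner_vec_def inner_prod_def sum.If_cases sum_negf of_bool_def
        if_distrib[of "\<lambda>x. x * _"] if_distrib[of uminus] Compl_eq cong: if_cong)
  moreover obtain v where "v \<in> I" "a \<bullet> vtx v \<le> a \<bullet> (x, y, t)"
    using hull_vtx_inner_le[OF assms(1), of a] by blast
  moreover obtain i j k where "v = (i, j, k)" by (cases v)
  ultimately show ?thesis
    by (auto simp: a_def inner_vtx of_bool_def split: if_splits)
qed

section \<open>The ten points and the vertices they force\<close>

definition edge_point :: "2 \<Rightarrow> 3 \<Rightarrow> (real^2) \<times> (real^2) \<times> (real^3)" where
  "edge_point j k =
    (\<chi> i. 1/2, \<chi> j'. if j' = j then 5/6 else 1/6, \<chi> k'. if k' = k then 3/4 else 1/8)"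

definition triangle_point :: "2 \<Rightarrow> 2 \<Rightarrow> (real^2) \<times> (real^2) \<times> (real^3)" where
  "triangle_point i j =
    (\<chi> i'. if i' = i then 5/6 else 1/6, \<chi> j'. if j' = j then 3/4 else 1/4, \<chi> k. 1/3)"

lemma sum_Compl_singleton: "sum f (- {i}) = sum f UNIV - f i" for f :: "'n::finite \<Rightarrow> real"
  using sum.subset_diff[of "{i}" UNIV f] by (simp add: Compl_eq_Diff_UNIV)

lemma card_Compl_singleton: "card (- {i :: 'n::finite}) = CARD('n) - 1"
  by (simp add: Compl_eq_Diff_UNIV)

text \<open>The constants of \<open>edge_point\<close> keep every union bound below 1. The sums to
  be bounded are, in order, 1/2 + 1/6 + 1/4 = 11/12, 5/6 + 1/8 = 23/24, 3/4 + 1/8 = 7/8 and 1/6 +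
  3/4 = 11/12.\<close>

lemma edge_point_hull:
  assumes "edge_point j k \<in> convex hull (vtx ` I)"
  shows "(i, j, k) \<in> I"
    and "k' \<noteq> k \<Longrightarrow> \<exists>i' j'' k''. (i', j'', k'') \<in> I \<and> j'' \<noteq> j \<and> k'' \<noteq> k'"
    and "k' \<noteq> k \<Longrightarrow> \<exists>i' j'' k''. (i', j'', k'') \<in> I \<and> k'' = k'"
    and "\<exists>i' j'' k''. (i', j'', k'') \<in> I \<and> j'' = j \<and> k'' \<noteq> k"
proof -
  note S = sum_Compl_singleton card_Compl_singleton sum_2 sum_3
  note hull = assms[unfolded edge_point_def]
  note ex = exhaust_2[of i] exhaust_2[of j] exhaust_3[of k] exhaust_3[of k']
  show "(i, j, k) \<in> I"
    using hull_meets_box[OF hull, of "{i}" "{j}" "{k}"] ex by (auto simp: S)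
  show "\<exists>i' j'' k''. (i', j'', k'') \<in> I \<and> j'' \<noteq> j \<and> k'' \<noteq> k'" if "k' \<noteq> k"
    using hull_meets_box[OF hull, of UNIV "-{j}" "-{k'}"] that by simp
  show "\<exists>i' j'' k''. (i', j'', k'') \<in> I \<and> k'' = k'" if "k' \<noteq> k"
    using hull_meets_box[OF hull, of UNIV UNIV "{k'}"] that ex by (auto simp: S)
  show "\<exists>i' j'' k''. (i', j'', k'') \<in> I \<and> j'' = j \<and> k'' \<noteq> k"
    using hull_meets_box[OF hull, of UNIV "{j}" "-{k}"] ex by (auto simp: S)
qed

text \<open>The first four sums are 1/4 + 2/3 = 11/12, 1/6 + 2/3 = 5/6, 1/6 + 1/4 + 1/3 = 3/4 and
  1/6 + 3/4 = 11/12, all below 1. The last claim counts hits instead: 1/6 + 1/4 + 2/3 = 13/12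
  exceeds 1.\<close>

lemma triangle_point_hull:
  assumes "triangle_point i j \<in> convex hull (vtx ` I)"
  shows "\<exists>i' j' k'. (i', j', k') \<in> I \<and> j' = j \<and> k' = k"
    and "\<exists>i' j' k'. (i', j', k') \<in> I \<and> i' = i \<and> k' = k"
    and "\<exists>i' j' k'. (i', j', k') \<in> I \<and> i' = i \<and> j' = j \<and> k' \<noteq> k"
    and "\<exists>i' j' k'. (i', j', k') \<in> I \<and> i' = i \<and> j' \<noteq> j"
    and "\<exists>i' j' k'. (i', j', k') \<in> I \<and> (i' \<noteq> i \<and> j' \<noteq> j \<or> i' \<noteq> i \<and> k' \<noteq> k \<or> j' \<noteq> j \<and> k' \<noteq> k)"
proof -
  note S = sum_Compl_singleton card_Compl_singleton sum_2 sum_3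
  note hull = assms[unfolded triangle_point_def]
  note ex = exhaust_2[of i] exhaust_2[of j]
  show "\<exists>i' j' k'. (i', j', k') \<in> I \<and> j' = j \<and> k' = k"
    using hull_meets_box[OF hull, of UNIV "{j}" "{k}"] ex by (auto simp: S)
  show "\<exists>i' j' k'. (i', j', k') \<in> I \<and> i' = i \<and> k' = k"
    using hull_meets_box[OF hull, of "{i}" UNIV "{k}"] ex by (auto simp: S)
  show "\<exists>i' j' k'. (i', j', k') \<in> I \<and> i' = i \<and> j' = j \<and> k' \<noteq> k"
    using hull_meets_box[OF hull, of "{i}" "{j}" "-{k}"] ex by (auto simp: S)
  show "\<exists>i' j' k'. (i', j', k') \<in> I \<and> i' = i \<and> j' \<noteq> j"
    using hull_meets_box[OF hull, of "{i}" "-{j}" UNIV] ex by (auto simp: S)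
  show "\<exists>i' j' k'. (i', j', k') \<in> I \<and> (i' \<noteq> i \<and> j' \<noteq> j \<or> i' \<noteq> i \<and> k' \<noteq> k \<or> j' \<noteq> j \<and> k' \<noteq> k)"
    using hull_vertex_in_two[OF hull, of "-{i}" "-{j}" "-{k}"] ex by (auto simp: S)
qed

section \<open>Five vertices cannot serve two of the points\<close>

lemma ex_other_two:
  "\<exists>k1 k2. k1 \<noteq> k \<and> k2 \<noteq> k \<and> k1 \<noteq> k2 \<and> (\<forall>k'. k' = k \<or> k' = k1 \<or> k' = k2)" for k :: 3
proof -
  have "\<forall>k'::3. k' = 1 \<or> k' = 2 \<or> k' = 3" by (simp add: exhaust_3)
  then have "?thesis" if "distinct [k, k1, k2]" "{1, 2, 3} \<subseteq> {k, k1, k2}" for k1 k2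
    using that by (intro exI[of _ k1] exI[of _ k2]) auto
  from this[of 2 3] this[of 1 3] this[of 1 2] show ?thesis
    using exhaust_3[of k] by auto
qed

lemma ge_6_elements:
  assumes "distinct vs" "length vs = 6" "set vs \<subseteq> I" "finite I"
  shows "\<not> card I \<le> 5"
  using card_mono[OF assms(4,3)] assms(1,2) by (simp add: distinct_card)

text \<open>Both edges, that is four vertices, must belong to \<open>I\<close>. In each case two
  further vertices \<open>v\<close> and \<open>w\<close> are found off these edges, which makes
  six.\<close>

lemma edge_edge:
  fixes I :: "(2 \<times> 2 \<times> 3) set"
  assumes "card I \<le> 5"
    and p: "edge_point j k \<in> convex hull (vtx ` I)" and q: "edge_point j' k' \<in> convex hull (vtx ` I)"
  shows "(j, k) = (j', k')"
proof (rule ccontr)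
  assume neq: "(j, k) \<noteq> (j', k')"
  note P = edge_point_hull[OF p] and Q = edge_point_hull[OF q]
  obtain k1 k2 where k12: "k1 \<noteq> k" "k2 \<noteq> k" "k1 \<noteq> k2" "\<And>k'. k' = k \<or> k' = k1 \<or> k' = k2"
    using ex_other_two[of k] by blast
  have 4: "(1, j, k) \<in> I" "(2, j, k) \<in> I" "(1, j', k') \<in> I" "(2, j', k') \<in> I"
    using P(1) Q(1) by auto
  have "\<exists>v w. v \<in> I \<and> w \<in> I \<and> distinct [(1, j, k), (2, j, k), (1, j', k'), (2, j', k'), v, w]"
  proof (cases "k = k'")
    case True
    obtain i1 j1 i2 j2 where "(i1, j1, k1) \<in> I" "(i2, j2, k2) \<in> I"
      using P(3) k12 by blast
    then show ?thesis using True neq k12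
      by (intro exI[of _ "(i1, j1, k1)"] exI[of _ "(i2, j2, k2)"]) auto
  next
    case k: False
    show ?thesis
    proof (cases "j = j'")
      case True
      \<comment> \<open>The third value of the last index: one extra vertex has it, the other avoids
        it and has a second index different from \<open>j\<close>, so it lies on neither
        edge.\<close>
      obtain k3 where k3: "k3 \<noteq> k" "k3 \<noteq> k'" using k12 by metis
      obtain i1 j1 where "(i1, j1, k3) \<in> I" using P(3) k3 by blast
      moreover obtain i2 j2 k4 where "(i2, j2, k4) \<in> I" "j2 \<noteq> j" "k4 \<noteq> k3" using P(2) k3 by blast
      ultimately show ?thesis using True k k3
        by (intro exI[of _ "(i1, j1, k3)"] exI[of _ "(i2, j2, k4)"]) auto
    next
      case False
      \<comment> \<open>The first vertex is off edge \<open>(j, k)\<close> by its second index and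
        off edge \<open>(j', k')\<close> by its third; for the second vertex these roles are
        exchanged. Their second indices differ.\<close>
      obtain i1 j1 k3 where "(i1, j1, k3) \<in> I" "j1 \<noteq> j" "k3 \<noteq> k'" using P(2)[of k'] k by auto
      moreover obtain i2 k4 where "(i2, j, k4) \<in> I" "k4 \<noteq> k" using P(4) by blast
      ultimately show ?thesis using False k
        by (intro exI[of _ "(i1, j1, k3)"] exI[of _ "(i2, j, k4)"]) auto
    qed
  qed
  then obtain v w where "v \<in> I" "w \<in> I"
    "distinct [(1, j, k), (2, j, k), (1, j', k'), (2, j', k'), v, w]" by blast
  then show False
    using ge_6_elements[of "[(1, j, k), (2, j, k), (1, j', k'), (2, j', k'), v, w]" I] 4 assms(1) by simp
qed

text \<open>Two triangles differ in their first or second index. Projecting \<open>I\<close> to that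
  index and the third one hits all six pairs of values.\<close>

lemma triangle_triangle:
  fixes I :: "(2 \<times> 2 \<times> 3) set"
  assumes "card I \<le> 5"
    and p: "triangle_point i j \<in> convex hull (vtx ` I)" and q: "triangle_point i' j' \<in> convex hull (vtx ` I)"
  shows "(i, j) = (i', j')"
proof (rule ccontr)
  assume neq: "(i, j) \<noteq> (i', j')"
  note P = triangle_point_hull[OF p] and Q = triangle_point_hull[OF q]
  show False
  proof (cases "i = i'")
    case True
    obtain a1 a2 a3 b1 b2 b3 where
      "(a1, j, 1) \<in> I" "(a2, j, 2) \<in> I" "(a3, j, 3) \<in> I"
      "(b1, j', 1) \<in> I" "(b2, j', 2) \<in> I" "(b3, j', 3) \<in> I"
      using P(1) Q(1) by metis
    then show False
      using ge_6_elements[of "[(a1, j, 1), (a2, j, 2), (a3, j, 3), (b1, j', 1), (b2, j', 2), (b3, j', 3)]" I]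
        True neq assms(1) by simp
  next
    case False
    obtain a1 a2 a3 b1 b2 b3 where
      "(i, a1, 1) \<in> I" "(i, a2, 2) \<in> I" "(i, a3, 3) \<in> I"
      "(i', b1, 1) \<in> I" "(i', b2, 2) \<in> I" "(i', b3, 3) \<in> I"
      using P(2) Q(2) by metis
    then show False
      using ge_6_elements[of "[(i, a1, 1), (i, a2, 2), (i, a3, 3), (i', b1, 1), (i', b2, 2), (i', b3, 3)]" I]
        False assms(1) by simp
  qed
qed

text \<open>If \<open>j\<close> differs from \<open>b\<close>, three vertices have second index
  \<open>b\<close> and three others have \<open>j\<close>. If \<open>j = b\<close>, five vertices
  are forced, which determines \<open>I\<close> so far that the condition with two simultaneous
  differences fails.\<close>

lemma edge_triangle:
  fixes I :: "(2 \<times> 2 \<times> 3) set"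
  assumes card: "card I \<le> 5"
    and p: "edge_point j k \<in> convex hull (vtx ` I)" and q: "triangle_point a b \<in> convex hull (vtx ` I)"
  shows False
proof -
  note P = edge_point_hull[OF p] and Q = triangle_point_hull[OF q]
  show False
  proof (cases "j = b")
    case False
    obtain a1 a2 a3 where "(a1, b, 1) \<in> I" "(a2, b, 2) \<in> I" "(a3, b, 3) \<in> I"
      using Q(1) by metis
    moreover obtain i k3 where "(i, j, k3) \<in> I" "k3 \<noteq> k" using P(4) by blast
    ultimately show False
      using ge_6_elements[of "[(a1, b, 1), (a2, b, 2), (a3, b, 3), (1, j, k), (2, j, k), (i, j, k3)]" I]
        P(1) False card by auto
  next
    case True
    obtain k1 k2 where k12: "k1 \<noteq> k" "k2 \<noteq> k" "k1 \<noteq> k2" "\<And>k'. k' = k \<or> k' = k1 \<or> k' = k2"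
      using ex_other_two[of k] by blast
    obtain i1 i2 where i12: "(i1, b, k1) \<in> I" "(i2, b, k2) \<in> I" using Q(1) by metis
    obtain i3 j3 k3 where 3: "(i3, j3, k3) \<in> I" "j3 \<noteq> b" "k3 \<noteq> k1"
      using P(2)[of k1] k12 True by auto
    let ?V = "{(1, b, k), (2, b, k), (i1, b, k1), (i2, b, k2), (i3, j3, k3)}"
    have "?V \<subseteq> I" using P(1) True i12 3 by auto
    moreover have "card ?V = 5" using k12 3 by auto
    ultimately have I: "I = ?V" using card by (metis card_seteq finite)
    \<comment> \<open>The only element with second index other than \<open>b\<close> is
      \<open>(i3, j3, k3)\<close>, so \<open>k3\<close> must avoid \<open>k2\<close> as well as
      \<open>k1\<close>.\<close>
    have "k3 = k" using P(2)[of k2] k12(1-3) k12(4)[of k3] 3(3) True unfolding I by auto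
    have "i1 = a" using Q(2)[of k1] k12 \<open>k3 = k\<close> unfolding I by auto
    have "i2 = a" using Q(2)[of k2] k12 \<open>k3 = k\<close> unfolding I by auto
    have "i3 = a" using Q(4) 3 unfolding I by auto
    \<comment> \<open>Every element now differs from \<open>(a, b, k)\<close> in at most one
      component.\<close>
    show False using Q(5)[of k] k12 3 unfolding I \<open>k3 = k\<close> \<open>i1 = a\<close> \<open>i2 = a\<close> \<open>i3 = a\<close> by auto
  qed
qed

section \<open>From simplices to the lower bound\<close>

lemma simplex_of_vertices_prism:
  assumes "simplex_of_vertices 4 prism_polytope S"
  obtains I where "card I = 5" "S = convex hull (vtx ` I)"
proof -
  obtain C V where C: "\<not> affine_dependent C" "card C = 5" "S = convex hull C"
    and V: "V \<subseteq> range vtx" "S = convex hull V"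
    using assms unfolding simplex_of_vertices_def simplex_def vertices_prism by auto
  \<comment> \<open>The affinely independent set \<open>C\<close> and the vertex set
    \<open>V\<close> come from separate parts of the definition. Points of \<open>C\<close> are
    extreme in the common hull, and extreme points of a hull belong to every generating set.\<close>
  have "C \<subseteq> V"
  proof
    fix v assume "v \<in> C"
    then have "v extreme_point_of convex hull V"
      using extreme_point_of_convex_hull_affine_independent[OF C(1)] C(3) V(2) by metis
    then show "v \<in> V" by (rule extreme_point_of_convex_hull)
  qed
  then have "C = vtx ` (vtx -` C)" using V(1) by auto
  moreover have "card (vtx -` C) = 5"
    using C(2) calculation card_image[of vtx "vtx -` C"] inj_vtx by (metis inj_on_subset subset_UNIV)
  ultimately show thesis using that C(3) by metis
qed

text \<open>The sum type indexes six edge points and four triangle points, so its cardinality is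
  ten.\<close>

definition witness_point :: "2 \<times> 3 + 2 \<times> 2 \<Rightarrow> (real^2) \<times> (real^2) \<times> (real^3)" where
  "witness_point = case_sum (\<lambda>(j, k). edge_point j k) (\<lambda>(i, j). triangle_point i j)"

lemma witness_point_in_prism: "witness_point a \<in> prism_polytope"
proof (cases a)
  case (Inl b)
  then obtain j k where "a = Inl (j, k)" by (cases b) auto
  then show ?thesis
    using exhaust_2[of j] exhaust_3[of k] by (auto simp: witness_point_def edge_point_def mem_prism_polytope)
next
  case (Inr b)
  then obtain i j where "a = Inr (i, j)" by (cases b) auto
  then show ?thesis
    using exhaust_2[of i] exhaust_2[of j] by (auto simp: witness_point_def triangle_point_def mem_prism_polytope)
qed

lemma witness_points_separated:
  assumes "card I \<le> 5" "witness_point a \<in> convex hull (vtx ` I)" "witness_point b \<in> convex hull (vtx ` I)"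
  shows "a = b"
  using assms(2,3) edge_triangle[OF assms(1)]
  by (cases a; cases b)
    (auto simp: witness_point_def dest: edge_edge[OF assms(1)] triangle_triangle[OF assms(1)])

text \<open>Choosing for each of the ten points a member of the cover that contains it gives an
  injection, by \<open>witness_points_separated\<close>.\<close>

lemma cover_lower_bound:
  assumes "simplicial_cover 4 prism_polytope \<C>"
  shows "10 \<le> card \<C>"
proof -
  have "finite \<C>" and simp: "\<And>S. S \<in> \<C> \<Longrightarrow> simplex_of_vertices 4 prism_polytope S" and "\<Union>\<C> = prism_polytope"
    using assms by (auto simp: simplicial_cover_def)
  then have "\<forall>a. \<exists>S\<in>\<C>. witness_point a \<in> S" using witness_point_in_prism by blast
  then obtain F where F: "F a \<in> \<C>" "witness_point a \<in> F a" for a by metis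
  have "inj F"
  proof
    fix a b assume "F a = F b"
    moreover obtain I where "card I = 5" "F a = convex hull (vtx ` I)"
      using simplex_of_vertices_prism[OF simp[OF F(1)]] .
    ultimately show "a = b"
      using witness_points_separated[of I a b] F(2)[of a] F(2)[of b] by simp
  qed
  then have "card (UNIV :: (2 \<times> 3 + 2 \<times> 2) set) \<le> card \<C>"
    using F(1) \<open>finite \<C>\<close> by (intro card_inj_on_le[of F]) auto
  then show ?thesis by simp
qed

section \<open>A regular triangulation with ten simplices\<close>

text \<open>The value 2 makes the coefficients of all ten functionals integers.\<close>

definition height :: "2 \<times> 2 \<times> 3 \<Rightarrow> real" where
  "height v = (if v \<in> {(1, 1, 1), (1, 2, 3), (2, 1, 3), (2, 2, 2)} then 0 else 2)"

text \<open>A normal form: since the coordinates of each factor sum to 1, every affine function on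
  the polytope is given by exactly one choice of the five coefficients. Constants arise from
  \<open>c = d = e\<close>.\<close>

definition height_functional :: "real \<Rightarrow> real \<Rightarrow> real \<Rightarrow> real \<Rightarrow> real \<Rightarrow> (real^2) \<times> (real^2) \<times> (real^3)" where
  "height_functional a b c d e = (vector [0, a], vector [0, b], vector [c, d, e])"

text \<open>Each functional interpolates the heights at the five vertices of its cell.\<close>

definition cells :: "((2 \<times> 2 \<times> 3) set \<times> ((real^2) \<times> (real^2) \<times> (real^3))) list" where
  "cells =
    [({(1,1,1), (1,1,2), (1,1,3), (1,2,3), (2,1,3)}, height_functional (-2) (-2) 0 2 2),
     ({(1,1,1), (1,1,2), (1,2,2), (1,2,3), (2,2,2)}, height_functional (-2) 0 0 2 0),
     ({(1,1,1), (1,1,2), (1,2,3), (2,1,3), (2,2,2)}, height_functional (-1) (-1) 0 2 1),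
     ({(1,1,1), (1,1,2), (2,1,2), (2,1,3), (2,2,2)}, height_functional 0 (-2) 0 2 0),
     ({(1,1,1), (1,2,1), (1,2,2), (1,2,3), (2,2,2)}, height_functional (-2) 2 0 0 (-2)),
     ({(1,1,1), (1,2,1), (1,2,3), (2,2,1), (2,2,2)}, height_functional 0 2 0 (-2) (-2)),
     ({(1,1,1), (1,2,3), (2,1,3), (2,2,1), (2,2,2)}, height_functional 1 1 0 (-2) (-1)),
     ({(1,1,1), (2,1,1), (2,1,2), (2,1,3), (2,2,2)}, height_functional 2 (-2) 0 0 (-2)),
     ({(1,1,1), (2,1,1), (2,1,3), (2,2,1), (2,2,2)}, height_functional 2 0 0 (-2) (-2)),
     ({(1,2,3), (2,1,3), (2,2,1), (2,2,2), (2,2,3)}, height_functional 2 2 (-2) (-4) (-2))]"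

lemma height_functional_vtx:
  "height_functional a b c d e \<bullet> vtx (i, j, k) =
    (if i = 2 then a else 0) + (if j = 2 then b else 0) + (if k = 1 then c else if k = 2 then d else e)"
  using exhaust_2[of i] exhaust_2[of j] exhaust_3[of k] by (auto simp: height_functional_def inner_vtx)

lemma height_functional_inner:
  "height_functional a b c d e \<bullet> (x, y, t) = a * x $ 2 + b * y $ 2 + c * t $ 1 + d * t $ 2 + e * t $ 3"
  by (simp add: height_functional_def inner_prod_def inner_vec_def sum_2 sum_3)

text \<open>The certificate of regularity, checked for each cell at all twelve vertices: the cells
  are lower facets of the lifted vertex set.\<close>

lemma cells_functional_le_height:
  assumes "(T, l) \<in> set cells"
  shows "l \<bullet> vtx v \<le> height v" "l \<bullet> vtx v = height v \<longleftrightarrow> v \<in> T"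
proof -
  have "\<forall>c\<in>set cells. \<forall>i j k. snd c \<bullet> vtx (i, j, k) \<le> height (i, j, k) \<and>
      (snd c \<bullet> vtx (i, j, k) = height (i, j, k) \<longleftrightarrow> (i, j, k) \<in> fst c)"
    by (simp add: cells_def forall_2 forall_3 height_functional_vtx height_def)
  with assms show "l \<bullet> vtx v \<le> height v" "l \<bullet> vtx v = height v \<longleftrightarrow> v \<in> T"
    by (cases v; force)+
qed

lemma cells_affine_independent:
  assumes "(T, l) \<in> set cells"
  shows "\<not> affine_dependent (vtx ` T)"
proof
  assume "affine_dependent (vtx ` T)"
  then obtain u where u: "sum u (vtx ` T) = 0" "\<exists>v\<in>vtx ` T. u v \<noteq> 0" "(\<Sum>v\<in>vtx ` T. u v *\<^sub>R v) = 0"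
    by (auto simp: affine_dependent_explicit_finite)
  have inj: "inj_on vtx T" using inj_vtx by (rule inj_on_subset) simp
  define w where "w = (\<lambda>v. u (vtx v))"
  have w: "(\<Sum>v\<in>T. w v *\<^sub>R vtx v) = 0" "\<exists>v\<in>T. w v \<noteq> 0"
    using u by (auto simp: sum.reindex[OF inj] w_def)
  \<comment> \<open>Inserting the five unit coefficient vectors gives a homogeneous linear system in
    the five weights, which for each cell has only the zero solution.\<close>
  have eqs: "(\<Sum>v\<in>T. w v * (height_functional a b c d e \<bullet> vtx v)) = 0" for a b c d e
    using arg_cong[OF w(1), of "\<lambda>q. height_functional a b c d e \<bullet> q"] by (simp add: inner_sum_right)
  have "\<forall>v\<in>T. w v = 0"
    using assms eqs[of 1 0 0 0 0] eqs[of 0 1 0 0 0] eqs[of 0 0 1 0 0] eqs[of 0 0 0 1 0] eqs[of 0 0 0 0 1]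
    unfolding cells_def list.set insert_iff empty_iff prod.inject
    by (elim disjE conjE FalseE; hypsubst; simp (no_asm_use) add: height_functional_vtx; intro conjI; linarith)
  with w(2) show False by blast
qed

lemma cells_card: "(T, l) \<in> set cells \<Longrightarrow> card T = 5"
  by (auto simp: cells_def)

lemma cells_distinct: "card (fst ` set cells) = 10"
proof -
  have "distinct (map fst cells)" by (simp add: cells_def set_eq_subset)
  then show ?thesis by (simp flip: distinct_card add: cells_def)
qed

section \<open>Locating a point in a cell\<close>

lemma convex_hull_5I:
  assumes "distinct [v1, v2, v3, v4, v5]" "0 \<le> u1" "0 \<le> u2" "0 \<le> u3" "0 \<le> u4" "0 \<le> u5"
    "u1 + u2 + u3 + u4 + u5 = 1"
    "p = u1 *\<^sub>R vtx v1 + u2 *\<^sub>R vtx v2 + u3 *\<^sub>R vtx v3 + u4 *\<^sub>R vtx v4 + u5 *\<^sub>R vtx v5"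
  shows "p \<in> convex hull (vtx ` {v1, v2, v3, v4, v5})"
proof -
  define u where "u = (\<lambda>_. 0)(v1 := u1, v2 := u2, v3 := u3, v4 := u4, v5 := u5)"
  have u: "u v1 = u1" "u v2 = u2" "u v3 = u3" "u v4 = u4" "u v5 = u5"
    using assms(1) by (simp_all add: u_def)
  have sum: "sum f {v1, v2, v3, v4, v5} = f v1 + f v2 + f v3 + f v4 + f v5" for f :: "_ \<Rightarrow> 'a::comm_monoid_add"
    using assms(1) by (simp add: add.assoc)
  have "p = (\<Sum>v\<in>{v1, v2, v3, v4, v5}. u v *\<^sub>R vtx v)" "sum u {v1, v2, v3, v4, v5} = 1"
    unfolding sum u using assms(7,8) by simp_all
  moreover have "\<forall>v\<in>{v1, v2, v3, v4, v5}. 0 \<le> u v"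
    using assms(2-6) u by simp
  ultimately show ?thesis unfolding convex_hull_vtx by blast
qed

text \<open>A point lies in the cell of any functional that is maximal there among the ten.\<close>

lemma cells_cover:
  assumes "p \<in> prism_polytope"
  shows "\<exists>(T, l)\<in>set cells. p \<in> convex hull (vtx ` T)"
proof -
  obtain x y t where p: "p = (x, y, t)" by (cases p)
  define h where "h = Max ((\<lambda>c. snd c \<bullet> p) ` set cells)"
  have "h \<in> (\<lambda>c. snd c \<bullet> p) ` set cells"
    unfolding h_def by (rule Max_in) (auto simp: cells_def)
  moreover have "\<forall>c\<in>set cells. snd c \<bullet> p \<le> h"
    unfolding h_def by auto
  ultimately obtain T l where Tl: "(T, l) \<in> set cells" and max: "\<forall>c\<in>set cells. snd c \<bullet> p \<le> l \<bullet> p"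
    by force
  have P: "0 \<le> x$1" "0 \<le> x$2" "x$1 = 1 - x$2" "0 \<le> y$1" "0 \<le> y$2" "y$1 = 1 - y$2"
    "0 \<le> t$1" "0 \<le> t$2" "0 \<le> t$3" "t$1 = 1 - t$2 - t$3"
    using assms unfolding p mem_prism_polytope by auto
  \<comment> \<open>Barycentric coordinates of \<open>(x, y, t)\<close> in each cell, in the order
    of \<open>cells\<close>. A single coordinate of the point belongs to a facet on the boundary of
    the polytope. Each other weight is a positive multiple of the cell's functional minus that of
    the neighbour across the opposite facet, hence nonnegative by maximality.\<close>
  note weights =
    convex_hull_5I[of "(1,1,1)" "(1,1,2)" "(1,1,3)" "(1,2,3)" "(2,1,3)"
      "t$1" "t$2" "t$3 - x$2 - y$2" "y$2" "x$2" "(x, y, t)"]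
    convex_hull_5I[of "(1,1,1)" "(1,1,2)" "(1,2,2)" "(1,2,3)" "(2,2,2)"
      "t$1" "t$2 + t$3 - y$2" "y$2 - x$2 - t$3" "t$3" "x$2" "(x, y, t)"]
    convex_hull_5I[of "(1,1,1)" "(1,1,2)" "(1,2,3)" "(2,1,3)" "(2,2,2)"
      "t$1" "(2 * t$2 + t$3 - x$2 - y$2)/2" "(y$2 + t$3 - x$2)/2" "(x$2 + t$3 - y$2)/2" "(x$2 + y$2 - t$3)/2" "(x, y, t)"]
    convex_hull_5I[of "(1,1,1)" "(1,1,2)" "(2,1,2)" "(2,1,3)" "(2,2,2)"
      "t$1" "t$2 + t$3 - x$2" "x$2 - y$2 - t$3" "t$3" "y$2" "(x, y, t)"]
    convex_hull_5I[of "(1,1,1)" "(1,2,1)" "(1,2,2)" "(1,2,3)" "(2,2,2)"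
      "y$1" "y$2 - t$2 - t$3" "t$2 - x$2" "t$3" "x$2" "(x, y, t)"]
    convex_hull_5I[of "(1,1,1)" "(1,2,1)" "(1,2,3)" "(2,2,1)" "(2,2,2)"
      "y$1" "y$2 - x$2 - t$3" "t$3" "x$2 - t$2" "t$2" "(x, y, t)"]
    convex_hull_5I[of "(1,1,1)" "(1,2,3)" "(2,1,3)" "(2,2,1)" "(2,2,2)"
      "(2 - x$2 - y$2 - t$3)/2" "(y$2 + t$3 - x$2)/2" "(x$2 + t$3 - y$2)/2" "(x$2 + y$2 - t$3 - 2 * t$2)/2" "t$2" "(x, y, t)"]
    convex_hull_5I[of "(1,1,1)" "(2,1,1)" "(2,1,2)" "(2,1,3)" "(2,2,2)"
      "x$1" "x$2 - t$2 - t$3" "t$2 - y$2" "t$3" "y$2" "(x, y, t)"]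
    convex_hull_5I[of "(1,1,1)" "(2,1,1)" "(2,1,3)" "(2,2,1)" "(2,2,2)"
      "x$1" "x$2 - y$2 - t$3" "t$3" "y$2 - t$2" "t$2" "(x, y, t)"]
    convex_hull_5I[of "(1,2,3)" "(2,1,3)" "(2,2,1)" "(2,2,2)" "(2,2,3)"
      "x$1" "y$1" "t$1" "t$2" "x$2 + y$2 + t$3 - 2" "(x, y, t)"]
  have "\<forall>c\<in>set cells. snd c \<bullet> (x, y, t) \<le> l \<bullet> (x, y, t)" using max by (simp add: p)
  then have "(x, y, t) \<in> convex hull (vtx ` T)"
    using Tl unfolding cells_def list.set insert_iff empty_iff prod.inject ball_simps snd_conv
    by (elim disjE conjE FalseE; hypsubst; simp only: height_functional_inner)
      ((rule weights, simp,
        (rule P | linarith | use P in linarith | rule divide_nonneg_pos, use P in linarith, simp |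
          (simp add: P add_divide_distrib diff_divide_distrib; fail))+,
        use P in \<open>simp add: vtx_def vec_eq_iff forall_2 forall_3 axis_def; argo\<close>)+)
  then show ?thesis using Tl p by auto
qed

text \<open>On the cell of \<open>T\<close> no functional exceeds \<open>l\<close>, because at its
  vertices \<open>l\<close> equals the height and the others are bounded by it. By symmetry
  \<open>l\<close> and \<open>l'\<close> agree at a common point.\<close>

lemma cells_Int:
  assumes "(T, l) \<in> set cells" "(T', l') \<in> set cells"
  shows "convex hull (vtx ` T) \<inter> convex hull (vtx ` T') = convex hull (vtx ` (T \<inter> T'))"
proof (intro equalityI subsetI IntI)
  have le: "l' \<bullet> p \<le> l \<bullet> p"
    if "(T, l) \<in> set cells" "(T', l') \<in> set cells" "p \<in> convex hull (vtx ` T)" for T T' l l' p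
  proof -
    have "vtx ` T \<subseteq> {q. (l' - l) \<bullet> q \<le> 0}"
    proof (rule image_subsetI)
      fix v assume "v \<in> T"
      then show "vtx v \<in> {q. (l' - l) \<bullet> q \<le> 0}"
        using cells_functional_le_height(2)[OF that(1), of v] cells_functional_le_height(1)[OF that(2), of v]
        by (simp add: inner_diff_left)
    qed
    then have "convex hull (vtx ` T) \<subseteq> {q. (l' - l) \<bullet> q \<le> 0}"
      by (intro hull_minimal convex_halfspace_le)
    then show ?thesis using that(3) by (auto simp: inner_diff_left)
  qed
  fix p assume p: "p \<in> convex hull (vtx ` T) \<inter> convex hull (vtx ` T')"
  then have eq: "l \<bullet> p = l' \<bullet> p"
    using le[OF assms, of p] le[OF assms(2,1), of p] by (intro antisym) auto
  obtain u where u: "\<forall>v\<in>T. 0 \<le> u v" "sum u T = 1" "p = (\<Sum>v\<in>T. u v *\<^sub>R vtx v)"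
    using p by (auto simp: convex_hull_vtx)
  have nn: "0 \<le> u v * (l \<bullet> vtx v - l' \<bullet> vtx v)" if "v \<in> T" for v
    using that u(1) cells_functional_le_height[OF assms(1), of v] cells_functional_le_height[OF assms(2), of v]
    by simp
  have "(\<Sum>v\<in>T. u v * (l \<bullet> vtx v - l' \<bullet> vtx v)) = 0"
    using eq by (simp add: u(3) inner_sum_right right_diff_distrib sum_subtractf)
  then have z: "\<forall>v\<in>T. u v * (l \<bullet> vtx v - l' \<bullet> vtx v) = 0"
    by (subst (asm) sum_nonneg_eq_0_iff) (use nn in auto)
  \<comment> \<open>At a vertex in \<open>T\<close> but not in \<open>T'\<close>, \<open>l\<close>
    reaches the height and \<open>l'\<close> stays strictly below, so the vanishing product forces
    weight 0.\<close>
  have "\<forall>v\<in>T - T \<inter> T'. u v = 0"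
    using z cells_functional_le_height(2)[OF assms(1)] cells_functional_le_height(2)[OF assms(2)]
    by force
  then have "sum u (T \<inter> T') = 1" "p = (\<Sum>v\<in>T \<inter> T'. u v *\<^sub>R vtx v)"
    unfolding u(2)[symmetric] u(3) by (intro sum.mono_neutral_left sum.mono_neutral_right; simp)+
  then show "p \<in> convex hull (vtx ` (T \<inter> T'))"
    using u(1) by (auto simp: convex_hull_vtx)
qed (meson hull_mono image_mono inf_le1 inf_le2 subsetD)+

section \<open>Assembling the triangulation\<close>

definition cell_triangulation :: "((real^2) \<times> (real^2) \<times> (real^3)) set set" where
  "cell_triangulation = (\<lambda>c. convex hull (vtx ` fst c)) ` set cells"

lemma cell_triangulationE:
  assumes "S \<in> cell_triangulation"
  obtains T l where "(T, l) \<in> set cells" "S = convex hull (vtx ` T)"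
  using assms by (auto simp: cell_triangulation_def)

lemma cell_simplex:
  assumes "(T, l) \<in> set cells"
  shows "4 simplex (convex hull (vtx ` T))"
  unfolding simplex_def
  using cells_affine_independent[OF assms] cells_card[OF assms] card_image[of vtx T] inj_vtx
  by (intro exI[of _ "vtx ` T"]) (auto intro: inj_on_subset)

text \<open>By affine independence the vertex set of a cell is recovered as the extreme points of
  its hull, so the ten index sets give ten different simplices.\<close>

lemma card_cell_triangulation: "card cell_triangulation = 10"
proof -
  have "inj_on (\<lambda>T. convex hull (vtx ` T)) (fst ` set cells)"
  proof (rule inj_onI)
    fix T T'
    assume "T \<in> fst ` set cells" "T' \<in> fst ` set cells" and eq: "convex hull (vtx ` T) = convex hull (vtx ` T')"
    then obtain l l' where a: "(T, l) \<in> set cells" "(T', l') \<in> set cells" by auto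
    have "vtx ` T = vtx ` T'"
      using extreme_point_of_convex_hull_affine_independent[OF cells_affine_independent[OF a(1)]]
        extreme_point_of_convex_hull_affine_independent[OF cells_affine_independent[OF a(2)]] eq
      by (auto simp: set_eq_iff)
    then show "T = T'" using inj_vtx by (simp add: inj_image_eq_iff)
  qed
  then have "card ((\<lambda>T. convex hull (vtx ` T)) ` fst ` set cells) = 10"
    by (simp add: card_image cells_distinct)
  then show ?thesis by (simp add: cell_triangulation_def image_image)
qed

lemma cell_triangulation_cover: "simplicial_cover 4 prism_polytope cell_triangulation"
proof -
  have "convex prism_polytope"
    by (simp add: prism_polytope_def std_simplex_def convex_Times)
  moreover have "vtx v \<in> prism_polytope" for v
    using vertices_prism by (force simp: vertices_def extreme_point_of_def)
  ultimately have "convex hull (vtx ` T) \<subseteq> prism_polytope" for T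
    by (intro hull_minimal) auto
  then have "\<Union>cell_triangulation = prism_polytope"
    using cells_cover unfolding cell_triangulation_def by fastforce
  moreover have "simplex_of_vertices 4 prism_polytope S" if S: "S \<in> cell_triangulation" for S
  proof -
    obtain T l where T: "(T, l) \<in> set cells" "S = convex hull (vtx ` T)"
      using S by (rule cell_triangulationE)
    then show ?thesis
      using cell_simplex[OF T(1)] unfolding simplex_of_vertices_def vertices_prism
      by (auto intro!: exI[of _ "vtx ` T"])
  qed
  ultimately show ?thesis by (simp add: simplicial_cover_def cell_triangulation_def)
qed

text \<open>By \<open>cells_Int\<close> two cells meet in the hull of a subset of the vertices of
  either, and such a hull is a face of a simplex.\<close>

lemma triangulation_cell_triangulation: "triangulation cell_triangulation"
proof -
  have "S \<inter> S' face_of S" if S: "S \<in> cell_triangulation" and S': "S' \<in> cell_triangulation" for S S'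
  proof -
    obtain T l where T: "(T, l) \<in> set cells" "S = convex hull (vtx ` T)"
      using S by (rule cell_triangulationE)
    obtain T' l' where T': "(T', l') \<in> set cells" "S' = convex hull (vtx ` T')"
      using S' by (rule cell_triangulationE)
    have "vtx ` (T \<inter> T') \<subseteq> vtx ` T" by blast
    then show ?thesis
      unfolding T(2) T'(2) cells_Int[OF T(1) T'(1)]
        face_of_convex_hull_affine_independent[OF cells_affine_independent[OF T(1)]]
      by blast
  qed
  moreover have "\<exists>n. n simplex S" if "S \<in> cell_triangulation" for S
    using cell_triangulationE[OF that] cell_simplex by metis
  moreover have "finite cell_triangulation"
    by (simp add: cell_triangulation_def)
  ultimately show ?thesis
    unfolding triangulation_def by blast
qed

theorem theorem21:
  shows "(\<exists>\<C>. simplicial_cover 4 prism_polytope \<C> \<and> card \<C> = 10) \<and>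
         (\<forall>\<C>. simplicial_cover 4 prism_polytope \<C> \<longrightarrow> 10 \<le> card \<C>) \<and>
         (\<exists>\<T>. vertex_triangulation 4 prism_polytope \<T> \<and> card \<T> = 10)"
  using cell_triangulation_cover card_cell_triangulation cover_lower_bound triangulation_cell_triangulation
  unfolding vertex_triangulation_def by (intro conjI exI[of _ cell_triangulation] allI impI)

end
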